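(* Let $\tau_{\boldsymbol{\Omega}}>0$ be a prescribed tolerance. Assume that there are constants $C_j$ and $q_j>0$, $j=1,\ldots,d$, such that for each $j=1,\ldots,d$ and all $s>0$, $$\left(\int_{\{\boldsymbol{\omega}\in\mathbb{R}^d:\,|\omega_j|>s\}}|\varphi(\boldsymbol{\omega})|^2\,d\boldsymbol{\omega}\right)^{1/2}\leq C_j\,s^{-q_j}.$$ Suppose that for every $j=1,\ldots,d$, $$\Omega_j\geq\max\left\{\kappa_j,\ \left(\frac{\sqrt d\,C_j}{(2\pi)^{d/2}\,\tau_{\boldsymbol{\Omega}}}\right)^{1/q_j}\right\},\qquad \kappa_j:=\frac{(K_j-1)\pi}{u_j-l_j}.$$ Then both of the following hold: (1) (coverage of the retained cosine frequencies) for every $j=1,\ldots,d$, the interval $[-\Omega_j,\Omega_j]$ contains all the points $\pm k_j\pi/(u_j-l_j)$, $k_j=0,1,\ldots,K_j-1$; (2) $\left\|\mathcal{F}-\tilde{\mathcal{F}}\right\|_F\leq\tau_{\boldsymbol{\Omega}}$.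
   Context: Let $d\ge 1$ and let $\mathbf{D}=D_1\times\cdots\times D_d\subset\mathbb{R}^d$ with $D_j=[l_j,u_j]$, $l_j<u_j$, be a finite hyperrectangle. Let $f$ be a continuous probability density on $\mathbb{R}^d$ whose restriction to $\mathbf{D}$ lies in $L^2(\mathbf{D})$, with characteristic function $\varphi(\boldsymbol{\omega})=\int_{\mathbb{R}^d}f(\mathbf{x})e^{i\boldsymbol{\omega}\cdot\mathbf{x}}\,d\mathbf{x}$. It is assumed that $f,\varphi\in L^1(\mathbb{R}^d)$, so that $f(\mathbf{x})=(2\pi)^{-d}\int_{\mathbb{R}^d}\varphi(\boldsymbol{\omega})e^{-i\boldsymbol{\omega}\cdot\mathbf{x}}\,d\boldsymbol{\omega}$. Let $K_1,\ldots,K_d\ge 1$ be integers (numbers of retained cosine terms). The retained multi-indices are $\mathbf{k}=(k_1,\ldots,k_d)$ with $0\le k_j\le K_j-1$. The normalized product cosine basis is $$\Phi_{\mathbf{k}}(\mathbf{x})=\prod_{j=1}^d\phi^{(j)}_{k_j}(x_j),\qquad \phi^{(j)}_{k}(x)=\beta^{(j)}_{k}\cos\!\left(\frac{k\pi}{u_j-l_j}(x-l_j)\right),$$ where $\beta^{(j)}_0=\sqrt{1/(u_j-l_j)}$ and $\beta^{(j)}_k=\sqrt{2/(u_j-l_j)}$ for $k\ge1$. The Fourier--cosine coefficient tensor $\mathcal{F}$ has entries $\mathcal{F}_{\mathbf{k}}=\int_{\mathbf{D}}f(\mathbf{x})\Phi_{\mathbf{k}}(\mathbf{x})\,d\mathbf{x}$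 over the retained multi-indices. For half-widths $\Omega_1,\ldots,\Omega_d>0$, let $\boldsymbol{\Omega}=[-\Omega_1,\Omega_1]\times\cdots\times[-\Omega_d,\Omega_d]$ and define the frequency-truncated coefficient tensor $\tilde{\mathcal{F}}$ over the retained multi-indices by $$\tilde{\mathcal{F}}_{\mathbf{k}}=\frac{1}{(2\pi)^d}\int_{\boldsymbol{\Omega}}\varphi(\boldsymbol{\omega})\,\boldsymbol{\Psi}_{\mathbf{k}}(\boldsymbol{\omega})\,d\boldsymbol{\omega},\qquad \boldsymbol{\Psi}_{\mathbf{k}}(\boldsymbol{\omega})=\int_{\mathbf{D}}e^{-i\boldsymbol{\omega}\cdot\mathbf{x}}\Phi_{\mathbf{k}}(\mathbf{x})\,d\mathbf{x}.$$ $\|\cdot\|_F$ denotes the Frobenius norm, i.e. $\|\mathcal{T}\|_F^2=\sum_{\mathbf{k}}|\mathcal{T}_{\mathbf{k}}|^2$ over the retained multi-indices. *)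

theory Defs
  imports "HOL-Analysis.Analysis"
begin

text \<open>
  The space \<open>\<real>\<^sup>d\<close> is rendered as \<^typ>\<open>real ^ 'n\<close> with \<open>d = CARD('n)\<close>, so coordinates
  are indexed by \<^typ>\<open>'n\<close> rather than by \<open>1, ..., d\<close>. The box with corners \<open>l\<close>, \<open>u\<close> is
  \<open>cbox l u\<close>, and multi-indices are functions of type \<open>'n \<Rightarrow> nat\<close>.
\<close>

definition joint_char_fun :: "(real ^ 'n \<Rightarrow> real) \<Rightarrow> real ^ 'n \<Rightarrow> complex" where
  "joint_char_fun f \<omega> = (LINT x|lborel. complex_of_real (f x) * exp (\<i> * complex_of_real (\<omega> \<bullet> x)))"

definition retained_indices :: "('n \<Rightarrow> nat) \<Rightarrow> ('n \<Rightarrow> nat) set" where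
  "retained_indices K = {k. \<forall>j. k j < K j}"

definition cosine_norm_const :: "real \<Rightarrow> real \<Rightarrow> nat \<Rightarrow> real" where
  "cosine_norm_const a b k = (if k = 0 then sqrt (1 / (b - a)) else sqrt (2 / (b - a)))"

definition cosine_basis :: "real \<Rightarrow> real \<Rightarrow> nat \<Rightarrow> real \<Rightarrow> real" where
  "cosine_basis a b k x = cosine_norm_const a b k * cos (real k * pi / (b - a) * (x - a))"

definition product_cosine_basis ::
    "real ^ 'n \<Rightarrow> real ^ 'n \<Rightarrow> ('n \<Rightarrow> nat) \<Rightarrow> real ^ 'n \<Rightarrow> real" where
  "product_cosine_basis l u k x = (\<Prod>j\<in>UNIV. cosine_basis (l $ j) (u $ j) (k j) (x $ j))"

definition cosine_coeff ::
    "(real ^ 'n \<Rightarrow> real) \<Rightarrow> real ^ 'n \<Rightarrow> real ^ 'n \<Rightarrow> ('n \<Rightarrow> nat) \<Rightarrow> real" where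
  "cosine_coeff f l u k = (LINT x:cbox l u|lborel. f x * product_cosine_basis l u k x)"

definition basis_transform ::
    "real ^ 'n \<Rightarrow> real ^ 'n \<Rightarrow> ('n \<Rightarrow> nat) \<Rightarrow> real ^ 'n \<Rightarrow> complex" where
  "basis_transform l u k \<omega> =
     (LINT x:cbox l u|lborel.
        exp (- \<i> * complex_of_real (\<omega> \<bullet> x)) * complex_of_real (product_cosine_basis l u k x))"

definition truncated_cosine_coeff ::
    "(real ^ 'n \<Rightarrow> real) \<Rightarrow> real ^ 'n \<Rightarrow> real ^ 'n \<Rightarrow> real ^ 'n \<Rightarrow> ('n \<Rightarrow> nat) \<Rightarrow> complex" where
  "truncated_cosine_coeff f l u \<Omega> k =
     1 / (2 * complex_of_real pi) ^ CARD('n) *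
     (LINT \<omega>:cbox (- \<Omega>) \<Omega>|lborel. joint_char_fun f \<omega> * basis_transform l u k \<omega>)"

definition frobenius_norm :: "('n \<Rightarrow> nat) \<Rightarrow> (('n \<Rightarrow> nat) \<Rightarrow> complex) \<Rightarrow> real" where
  "frobenius_norm K T = sqrt (\<Sum>k\<in>retained_indices K. (cmod (T k))\<^sup>2)"

end

theory Submission
  imports Defs "HOL-Probability.Characteristic_Functions"
begin

text \<open>
  Extended by zero, the basis functions \<open>\<Phi>\<^sub>k\<close> are orthonormal in \<open>L\<^sup>2(\<real>\<^sup>d)\<close>. By Parseval, the
  coefficient \<open>\<F>\<^sub>k\<close> is the integral of \<open>\<phi> \<Psi>\<^sub>k\<close> over all frequencies, divided by \<open>(2\<pi>)\<^sup>d\<close>, so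
  truncation loses the part outside \<open>\<Omega>\<close>. By Fubini this part is the \<open>k\<close>-th cosine coefficient
  of the inverse Fourier transform of \<open>\<phi>\<close> restricted to the complement of \<open>\<Omega>\<close>. Bessel's inequality and
  the bound in Plancherel's theorem then estimate the squared Frobenius norm by \<open>(2\<pi>)\<^sup>-\<^sup>d\<close> times the
  integral of \<open>|\<phi>|\<^sup>2\<close> over the complement of \<open>\<Omega>\<close>. That complement is covered by the \<open>d\<close> sets
  \<open>|\<omega>\<^sub>j| > \<Omega>\<^sub>j\<close>, and each of them contributes at most \<open>\<tau>\<^sup>2 / d\<close>.

  Parseval and Plancherel are proved by inserting a Gaussian weight \<open>exp (- |\<omega>|\<^sup>2 / 2s\<^sup>2)\<close>, whose Fourier
  transform is a positive kernel of mass \<open>(2\<pi>)\<^sup>d\<close>, and letting \<open>s\<close> tend to infinity. Parseval needs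
  one factor to be bounded and continuous only almost everywhere, so the jump of \<open>\<Phi>\<^sub>k\<close> at the boundary of
  the box does no harm.
\<close>

section \<open>The Fourier transform on a Euclidean space\<close>

text \<open>Supplies the dominating function for the exchange of integrals in
  \<open>fourier_multiplication_formula\<close>, where the oscillating exponential has modulus
  one.\<close>

lemma integrable_tensor:
  fixes f :: "'a \<Rightarrow> complex" and g :: "'b \<Rightarrow> complex"
  assumes "sigma_finite_measure M" "sigma_finite_measure N"
    and f: "integrable M f" and g: "integrable N g"
  shows "integrable (M \<Otimes>\<^sub>M N) (\<lambda>(x, y). f x * g y)"
proof -
  interpret M: sigma_finite_measure M by fact
  interpret N: sigma_finite_measure N by fact
  interpret pair_sigma_finite M N ..
  have [measurable]: "f \<in> borel_measurable M" "g \<in> borel_measurable N"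
    using f g by auto
  show ?thesis
    by (rule Fubini_integrable) (use f g in \<open>auto simp: norm_mult\<close>)
qed

text \<open>Sign and normalization follow the characteristic function, so the inverse transform of
  \<open>H\<close> at \<open>x\<close> is \<open>fourier H (- x)\<close> divided by
  \<open>(2 * pi) ^ DIM('a)\<close>.\<close>

definition fourier :: "('a::euclidean_space \<Rightarrow> complex) \<Rightarrow> 'a \<Rightarrow> complex" where
  "fourier F w = (LINT x|lborel. F x * exp (\<i> * complex_of_real (w \<bullet> x)))"

lemma integrable_fourier_integrand:
  assumes "integrable lborel F"
  shows "integrable lborel (\<lambda>x::'a::euclidean_space. F x * exp (\<i> * complex_of_real (w \<bullet> x)))"
proof (rule Bochner_Integration.integrable_bound[OF assms])
  have [measurable]: "F \<in> borel_measurable borel"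
    using assms by (simp add: borel_measurable_integrable)
  show "(\<lambda>x. F x * exp (\<i> * complex_of_real (w \<bullet> x))) \<in> borel_measurable lborel"
    by measurable
qed (simp add: norm_mult)

lemma borel_measurable_fourier [measurable]:
  assumes [measurable]: "F \<in> borel_measurable borel"
  shows "fourier F \<in> borel_measurable borel"
proof -
  have "(\<lambda>w. LINT x|lborel. F x * exp (\<i> * complex_of_real (w \<bullet> x))) \<in> borel_measurable borel"
    by measurable
  then show ?thesis
    by (simp add: fourier_def[abs_def])
qed

lemma norm_fourier_le: "cmod (fourier F w) \<le> (LINT x|lborel. cmod (F x))"
proof -
  have "cmod (fourier F w) \<le> (LINT x|lborel. cmod (F x * exp (\<i> * complex_of_real (w \<bullet> x))))"
    unfolding fourier_def by (rule integral_norm_bound)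
  then show ?thesis by (simp add: norm_mult)
qed

text \<open>Allows \<open>(cmod (fourier F w))\<^sup>2\<close> to be read as
  \<open>fourier F w * fourier H (- w)\<close>, where \<open>H\<close> is the conjugate of
  \<open>F\<close>.\<close>

lemma cnj_fourier: "cnj (fourier F w) = fourier (\<lambda>x. cnj (F x)) (- w)"
  unfolding fourier_def by (subst Bochner_Integration.integral_cnj[symmetric]) (simp add: exp_cnj)

lemma integrable_mult_fourier:
  fixes F H :: "'a::euclidean_space \<Rightarrow> complex"
  assumes F: "integrable lborel F" and H: "integrable lborel H"
  shows "integrable lborel (\<lambda>w. H w * fourier F (c *\<^sub>R w))"
proof (rule Bochner_Integration.integrable_bound)
  show "integrable lborel (\<lambda>w. (LINT x|lborel. cmod (F x)) * cmod (H w))"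
    using H by auto
  have [measurable]: "F \<in> borel_measurable borel" "H \<in> borel_measurable borel"
    using F H by (simp_all add: borel_measurable_integrable)
  show "(\<lambda>w. H w * fourier F (c *\<^sub>R w)) \<in> borel_measurable lborel"
    by measurable
  show "AE w in lborel. cmod (H w * fourier F (c *\<^sub>R w)) \<le> norm ((LINT x|lborel. cmod (F x)) * cmod (H w))"
    using mult_right_mono[OF norm_fourier_le norm_ge_zero]
    by (auto simp: norm_mult mult.commute)
qed

text \<open>The exponential is symmetric in \<open>w\<close> and \<open>x\<close>, so Fubini moves
  the transform from one factor to the other. The choice \<open>c = -1\<close> covers transforms at
  a reflected argument.\<close>

lemma fourier_multiplication_formula:
  fixes F H :: "'a::euclidean_space \<Rightarrow> complex"
  assumes F: "integrable lborel F" and H: "integrable lborel H"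
  shows "(LINT w|lborel. H w * fourier F (c *\<^sub>R w)) = (LINT x|lborel. F x * fourier H (c *\<^sub>R x))"
proof -
  have [measurable]: "F \<in> borel_measurable borel" "H \<in> borel_measurable borel"
    using F H by (simp_all add: borel_measurable_integrable)
  have int: "integrable (lborel \<Otimes>\<^sub>M lborel)
      (\<lambda>(w, x). H w * (F x * exp (\<i> * complex_of_real ((c *\<^sub>R w) \<bullet> x))))"
    by (rule Bochner_Integration.integrable_bound[OF integrable_tensor[OF _ _ H F]])
       (auto simp: norm_mult sigma_finite_lborel)
  have "(LINT w|lborel. H w * fourier F (c *\<^sub>R w)) =
      (LINT w|lborel. LINT x|lborel. H w * (F x * exp (\<i> * complex_of_real ((c *\<^sub>R w) \<bullet> x))))"
    by (simp add: fourier_def)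
  also have "\<dots> = (LINT x|lborel. LINT w|lborel. H w * (F x * exp (\<i> * complex_of_real ((c *\<^sub>R w) \<bullet> x))))"
    by (rule lborel_pair.Fubini_integral[OF int, symmetric])
  also have "\<dots> = (LINT x|lborel. LINT w|lborel. F x * (H w * exp (\<i> * complex_of_real ((c *\<^sub>R x) \<bullet> w))))"
    by (simp add: inner_commute mult.left_commute)
  also have "\<dots> = (LINT x|lborel. F x * fourier H (c *\<^sub>R x))"
    by (simp add: fourier_def)
  finally show ?thesis .
qed

section \<open>Integrals of products and Gaussians\<close>

text \<open>By \<open>lborel_eq\<close>, Lebesgue measure is the image of a product of
  one-dimensional ones under assembly of coordinates, which reduces the claim to Fubini for finite
  products.\<close>

lemma
  fixes f :: "'a::euclidean_space \<Rightarrow> real \<Rightarrow> 'c::{real_normed_field,banach,second_countable_topology}"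
  assumes f: "\<And>b. b \<in> Basis \<Longrightarrow> integrable lborel (f b)"
  shows integrable_lborel_prod: "integrable lborel (\<lambda>x. \<Prod>b\<in>Basis. f b (x \<bullet> b))"
    and integral_lborel_prod:
      "(LINT x|lborel. (\<Prod>b\<in>Basis. f b (x \<bullet> b))) = (\<Prod>b\<in>Basis. (LINT t|lborel. f b t))"
proof -
  interpret product_sigma_finite "\<lambda>b::'a. lborel :: real measure" ..
  have [measurable]: "f b \<in> borel_measurable borel" if "b \<in> Basis" for b
    using f[OF that] by (simp add: borel_measurable_integrable)
  have coord: "(\<Sum>b\<in>Basis. x b *\<^sub>R b) \<bullet> c = x c" if "c \<in> Basis" for x :: "'a \<Rightarrow> real" and c
    using that by (simp add: inner_sum_left inner_Basis if_distrib sum.delta cong: if_cong)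
  have m: "(\<lambda>x. \<Prod>b\<in>Basis. f b (x \<bullet> b)) \<in> borel_measurable borel"
    by measurable
  show "integrable lborel (\<lambda>x. \<Prod>b\<in>Basis. f b (x \<bullet> b))"
    using product_integrable_prod[OF finite_Basis f]
    by (subst lborel_eq, subst integrable_distr_eq[OF _ m]) (simp_all add: coord)
  show "(LINT x|lborel. (\<Prod>b\<in>Basis. f b (x \<bullet> b))) = (\<Prod>b\<in>Basis. (LINT t|lborel. f b t))"
    using product_integral_prod[OF finite_Basis f]
    by (subst lborel_eq, subst integral_distr[OF _ m]) (simp_all add: coord)
qed

lemma lborel_integrable_affine:
  fixes h :: "'a::euclidean_space \<Rightarrow> 'b::{banach, second_countable_topology}"
  assumes h: "integrable lborel h" and c: "c \<noteq> 0"
  shows "integrable lborel (\<lambda>x. h (t + c *\<^sub>R x))"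
proof -
  have [measurable]: "h \<in> borel_measurable borel"
    using h by (simp add: borel_measurable_integrable)
  have "integrable (density (distr lborel borel (\<lambda>x. t + c *\<^sub>R x)) (\<lambda>_. \<bar>c\<bar>^DIM('a))) h"
    using h lborel_affine[OF c, of t] by simp
  then have "integrable lborel (\<lambda>x. \<bar>c\<bar>^DIM('a) *\<^sub>R h (t + c *\<^sub>R x))"
    by (subst (asm) integrable_density) (simp_all add: integrable_distr_eq)
  then have "integrable lborel (\<lambda>x. (1 / \<bar>c\<bar>^DIM('a)) *\<^sub>R \<bar>c\<bar>^DIM('a) *\<^sub>R h (t + c *\<^sub>R x))"
    by (rule integrable_scaleR_right)
  then show ?thesis
    using c by simp
qed

text \<open>Used with \<open>c = -1\<close> to reflect a kernel and with \<open>c = 1 / s\<close> to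
  zoom in on the point where it concentrates.\<close>

lemma lborel_integral_affine:
  fixes h :: "'a::euclidean_space \<Rightarrow> 'b::{banach, second_countable_topology}"
  assumes [measurable]: "h \<in> borel_measurable borel" and c: "c \<noteq> 0"
  shows "(LINT x|lborel. h x) = \<bar>c\<bar> ^ DIM('a) *\<^sub>R (LINT x|lborel. h (t + c *\<^sub>R x))"
proof -
  have "(LINT x|lborel. h x) = (LINT x|density (distr lborel borel (\<lambda>x. t + c *\<^sub>R x)) (\<lambda>_. \<bar>c\<bar>^DIM('a)). h x)"
    using lborel_affine[OF c, of t] by simp
  also have "\<dots> = \<bar>c\<bar> ^ DIM('a) *\<^sub>R (LINT x|lborel. h (t + c *\<^sub>R x))"
    by (subst integral_density) (simp_all add: integral_distr)
  finally show ?thesis .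
qed

text \<open>A convergence factor rather than a probability density: its value at the origin is 1,
  and for growing positive \<open>s\<close> it increases pointwise to 1.\<close>

definition gauss :: "real \<Rightarrow> 'a::euclidean_space \<Rightarrow> real" where
  "gauss s w = exp (- (norm w)\<^sup>2 / (2 * s\<^sup>2))"

text \<open>A Gaussian of width \<open>1 / s\<close>, so large \<open>s\<close> means small time in
  the heat flow. The prefactor makes it the Fourier transform of \<open>gauss s\<close>.\<close>

definition heat_kernel :: "real \<Rightarrow> 'a::euclidean_space \<Rightarrow> real" where
  "heat_kernel s x = (sqrt (2 * pi) * s) ^ DIM('a) * gauss (1 / s) x"

lemma borel_measurable_gauss [measurable]: "gauss s \<in> borel_measurable borel"
  unfolding gauss_def[abs_def] by measurable

lemma gauss_pos: "0 < gauss s w" and gauss_le_1: "gauss s w \<le> 1"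
  by (simp_all add: gauss_def)

text \<open>Rescaling by \<open>s\<close> turns the Gaussian into the standard normal density times
  \<open>sqrt (2 * pi)\<close>, and the characteristic function of that density is known.\<close>

lemma
  assumes s: "0 < s"
  shows integrable_gauss_real: "integrable lborel (gauss s :: real \<Rightarrow> real)"
    and fourier_gauss_real:
      "fourier (\<lambda>x. complex_of_real (gauss s x)) (t::real) = complex_of_real (heat_kernel s t)"
proof -
  have g1: "gauss 1 x = sqrt (2 * pi) * std_normal_density x" for x :: real
    by (simp add: gauss_def std_normal_density_def)
  have gs: "gauss s (0 + s * x) = gauss 1 x" for x :: real
    using s by (simp add: gauss_def power_mult_distrib)
  have "integrable lborel (gauss 1 :: real \<Rightarrow> real)"
    unfolding g1[abs_def] by (intro integrable_mult_right) simp
  then show "integrable lborel (gauss s :: real \<Rightarrow> real)"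
    using lborel_integrable_real_affine_iff[of s "gauss s" 0] s by (simp only: gs)
  have "fourier (\<lambda>x. complex_of_real (gauss s x)) t
      = s *\<^sub>R (LINT x|lborel. complex_of_real (gauss 1 x) * exp (\<i> * complex_of_real (t * (s * x))))"
    unfolding fourier_def using s
    by (subst lborel_integral_real_affine[of s _ 0]) (use gs in auto)
  also have "(LINT x|lborel. complex_of_real (gauss 1 x) * exp (\<i> * complex_of_real (t * (s * x))))
      = complex_of_real (sqrt (2 * pi)) * (LINT x|lborel. std_normal_density x *\<^sub>R iexp ((t * s) * x))"
    unfolding g1 by (subst integral_mult_right_zero[symmetric])
      (simp add: scaleR_conv_of_real mult_ac)
  also have "(LINT x|lborel. std_normal_density x *\<^sub>R iexp ((t * s) * x))
      = char std_normal_distribution (t * s)"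
    unfolding char_def by (subst integral_density) auto
  also have "\<dots> = complex_of_real (exp (- ((t * s)\<^sup>2) / 2))"
    by (simp add: char_std_normal_distribution)
  finally show "fourier (\<lambda>x. complex_of_real (gauss s x)) t = complex_of_real (heat_kernel s t)"
    using s by (simp add: heat_kernel_def gauss_def scaleR_conv_of_real power_mult_distrib
        power_divide field_simps)
qed

lemma gauss_eq_prod: "gauss s w = (\<Prod>b\<in>Basis. gauss s (w \<bullet> b))"
  unfolding gauss_def exp_sum[OF finite_Basis, symmetric] power2_norm_eq_inner
  by (subst euclidean_inner) (simp only: sum_negf sum_divide_distrib[symmetric] inner_real_def)

text \<open>Both the Gaussian and the exponential factor over the coordinates, so the
  one-dimensional transform applies along each axis.\<close>

lemma
  fixes x :: "'a::euclidean_space"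
  assumes s: "0 < s"
  shows integrable_gauss: "integrable lborel (gauss s :: 'a \<Rightarrow> real)"
    and fourier_gauss:
      "fourier (\<lambda>w. complex_of_real (gauss s w)) x = complex_of_real (heat_kernel s x)"
proof -
  show "integrable lborel (gauss s :: 'a \<Rightarrow> real)"
    by (subst gauss_eq_prod[abs_def], rule integrable_lborel_prod[OF integrable_gauss_real[OF s]])
  have e: "exp (\<i> * complex_of_real (x \<bullet> w)) = (\<Prod>b\<in>Basis. exp (\<i> * complex_of_real ((x \<bullet> b) * (w \<bullet> b))))"
    for w
    by (subst euclidean_inner) (simp only: exp_sum[OF finite_Basis, symmetric] sum_distrib_left of_real_sum)
  have int: "integrable lborel (\<lambda>t. complex_of_real (gauss s t) * exp (\<i> * complex_of_real (r * t)))" for r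
    using integrable_fourier_integrand[of "\<lambda>t. complex_of_real (gauss s t)" r] integrable_gauss_real[OF s]
    by simp
  have "fourier (\<lambda>w. complex_of_real (gauss s w)) x =
      (LINT w|lborel. (\<Prod>b\<in>Basis. complex_of_real (gauss s (w \<bullet> b)) * exp (\<i> * complex_of_real ((x \<bullet> b) * (w \<bullet> b)))))"
    unfolding fourier_def e by (subst gauss_eq_prod) (simp add: prod.distrib)
  also have "\<dots> = (\<Prod>b\<in>Basis. fourier (\<lambda>t. complex_of_real (gauss s t)) (x \<bullet> b))"
    by (subst integral_lborel_prod[OF int]) (simp add: fourier_def)
  also have "\<dots> = complex_of_real (heat_kernel s x)"
    unfolding fourier_gauss_real[OF s] heat_kernel_def gauss_eq_prod[of "1/s" x]
    by (simp add: prod.distrib)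
  finally show "fourier (\<lambda>w. complex_of_real (gauss s w)) x = complex_of_real (heat_kernel s x)" .
qed

lemma heat_kernel_pos: "0 < s \<Longrightarrow> 0 < heat_kernel s x"
  by (simp add: heat_kernel_def gauss_pos)

lemma heat_kernel_minus: "heat_kernel s (- x) = heat_kernel s x"
  by (simp add: heat_kernel_def gauss_def)

lemma borel_measurable_heat_kernel [measurable]: "heat_kernel s \<in> borel_measurable borel"
  unfolding heat_kernel_def[abs_def] by measurable

text \<open>The integral of \<open>gauss (1 / s)\<close> is its Fourier transform at the origin,
  hence \<open>heat_kernel (1 / s) 0\<close>. In the product with the prefactor, \<open>s\<close>
  cancels.\<close>

lemma
  assumes s: "0 < s"
  shows integrable_heat_kernel: "integrable lborel (heat_kernel s :: 'a::euclidean_space \<Rightarrow> real)"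
    and integral_heat_kernel: "(LINT x|lborel. heat_kernel s (x::'a)) = (2 * pi) ^ DIM('a)"
proof -
  have s': "0 < 1 / s" using s by simp
  show "integrable lborel (heat_kernel s :: 'a \<Rightarrow> real)"
    unfolding heat_kernel_def[abs_def] by (intro integrable_mult_right integrable_gauss s')
  have "complex_of_real (LINT x|lborel. gauss (1 / s) (x::'a)) = complex_of_real (heat_kernel (1 / s) (0::'a))"
    using fourier_gauss[OF s', of "0::'a"] by (simp add: fourier_def)
  then have "(LINT x|lborel. gauss (1 / s) (x::'a)) = (sqrt (2 * pi) / s) ^ DIM('a)"
    by (simp only: of_real_eq_iff) (simp add: heat_kernel_def gauss_def)
  moreover have c: "sqrt (2 * pi) * s * (sqrt (2 * pi) / s) = 2 * pi"
    using s by (simp add: field_simps del: real_sqrt_mult)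
  ultimately show "(LINT x|lborel. heat_kernel s (x::'a)) = (2 * pi) ^ DIM('a)"
    by (simp only: heat_kernel_def integral_mult_right_zero c flip: power_mult_distrib)
qed

lemma gauss_tendsto_1: "(\<lambda>n. gauss (real (Suc n)) w) \<longlonglongrightarrow> 1"
proof -
  have "(\<lambda>n. exp (- ((norm w)\<^sup>2 / 2 * (inverse (real (Suc n)))\<^sup>2))) \<longlonglongrightarrow> exp (- ((norm w)\<^sup>2 / 2 * 0\<^sup>2))"
    by (intro tendsto_intros LIMSEQ_inverse_real_of_nat)
  then show ?thesis
    by (simp add: gauss_def power_inverse field_simps)
qed

lemma gauss_mono: "0 < r \<Longrightarrow> r \<le> s \<Longrightarrow> gauss r w \<le> gauss s w"
  by (simp add: gauss_def frac_le power_mono)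

text \<open>The power of \<open>s\<close> will cancel the Jacobian of the substitution, leaving a
  kernel independent of \<open>s\<close>.\<close>

lemma heat_kernel_rescale:
  "0 < s \<Longrightarrow> heat_kernel s ((1 / s) *\<^sub>R z) = s ^ DIM('a) * heat_kernel 1 (z :: 'a::euclidean_space)"
  by (simp add: heat_kernel_def gauss_def power_mult_distrib power_divide)

lemma
  shows integrable_heat_kernel_diff:
      "0 < s \<Longrightarrow> integrable lborel (\<lambda>x. heat_kernel s (y - x :: 'a::euclidean_space))"
    and integral_heat_kernel_diff:
      "0 < s \<Longrightarrow> (LINT x|lborel. heat_kernel s (y - x :: 'a)) = (2 * pi) ^ DIM('a)"
  using lborel_integrable_affine[of "heat_kernel s :: 'a \<Rightarrow> real" "-1" y]
    lborel_integral_affine[of "heat_kernel s :: 'a \<Rightarrow> real" "-1" y]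
  by (simp_all add: integrable_heat_kernel integral_heat_kernel)

section \<open>Parseval and Plancherel\<close>

text \<open>The multiplication formula is applied twice, once for \<open>F\<close> and once for
  \<open>H\<close>; what remains is the transform of a modulated Gaussian. The weight makes every
  integral converge absolutely for arbitrary integrable \<open>F\<close> and
  \<open>H\<close>.\<close>

lemma gauss_weighted_parseval:
  fixes F H :: "'a::euclidean_space \<Rightarrow> complex"
  assumes F: "integrable lborel F" and H: "integrable lborel H" and s: "0 < s"
  shows "(LINT w|lborel. fourier F w * fourier H (- w) * complex_of_real (gauss s w)) =
    (LINT y|lborel. F y * (LINT x|lborel. H x * complex_of_real (heat_kernel s (y - x))))"
proof -
  let ?g = "\<lambda>w::'a. complex_of_real (gauss s w)"
  have g: "integrable lborel ?g" by (simp add: integrable_gauss[OF s])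
  have 1: "integrable lborel (\<lambda>w. ?g w * fourier H (- w))"
    using integrable_mult_fourier[OF H g, of "-1"] by simp
  have 2: "fourier (\<lambda>w. ?g w * fourier H (- w)) y =
      (LINT x|lborel. H x * complex_of_real (heat_kernel s (y - x)))" for y
  proof -
    \<comment> \<open>Modulation translates the transform, which is how the difference
      \<open>y - x\<close> enters the heat kernel.\<close>
    have char: "exp (\<i> * complex_of_real (y \<bullet> w)) * exp (\<i> * complex_of_real (((-1) *\<^sub>R x) \<bullet> w)) =
        exp (\<i> * complex_of_real ((y - x) \<bullet> w))" for w x
      by (simp add: inner_diff_left algebra_simps flip: exp_add)
    have shift: "fourier (\<lambda>w. ?g w * exp (\<i> * complex_of_real (y \<bullet> w))) ((-1) *\<^sub>R x) = fourier ?g (y - x)" for x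
      unfolding fourier_def by (simp only: mult.assoc char)
    have "fourier (\<lambda>w. ?g w * fourier H (- w)) y =
        (LINT w|lborel. (?g w * exp (\<i> * complex_of_real (y \<bullet> w))) * fourier H ((-1) *\<^sub>R w))"
      unfolding fourier_def[of "\<lambda>w. ?g w * fourier H (- w)"] by (simp add: mult_ac)
    also have "\<dots> = (LINT x|lborel. H x * fourier (\<lambda>w. ?g w * exp (\<i> * complex_of_real (y \<bullet> w))) ((-1) *\<^sub>R x))"
      by (rule fourier_multiplication_formula[OF H integrable_fourier_integrand[OF g]])
    finally show ?thesis
      by (simp only: shift fourier_gauss[OF s])
  qed
  have "(LINT w|lborel. fourier F w * fourier H (- w) * ?g w) =
      (LINT w|lborel. (?g w * fourier H (- w)) * fourier F (1 *\<^sub>R w))"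
    by (simp add: mult_ac)
  also have "\<dots> = (LINT y|lborel. F y * fourier (\<lambda>w. ?g w * fourier H (- w)) (1 *\<^sub>R y))"
    by (rule fourier_multiplication_formula[OF F 1])
  finally show ?thesis by (simp add: 2)
qed

text \<open>Both sides of the weighted identity are passed to the limit by dominated convergence. On
  the left \<open>fourier F\<close> is integrable and \<open>fourier p\<close> bounded; on the right
  the averages of \<open>p\<close> against the shrinking kernel are uniformly bounded and converge
  wherever \<open>p\<close> is continuous.\<close>

lemma parseval_fourier:
  fixes F p :: "'a::euclidean_space \<Rightarrow> complex"
  assumes F: "integrable lborel F" and p: "integrable lborel p"
    and bounded: "\<And>x. cmod (p x) \<le> B" and cont: "AE y in lborel. isCont p y"
    and fF: "integrable lborel (fourier F)"
  shows "(LINT w|lborel. fourier F w * fourier p (- w)) =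
    (2 * complex_of_real pi) ^ DIM('a) * (LINT y|lborel. F y * p y)"
proof -
  have [measurable]: "F \<in> borel_measurable borel" "p \<in> borel_measurable borel"
    using F p by (simp_all add: borel_measurable_integrable)
  let ?s = "\<lambda>n. real (Suc n)"
  let ?I = "\<lambda>n y. LINT x|lborel. p x * complex_of_real (heat_kernel (?s n) (y - x))"
  have hk: "integrable lborel (\<lambda>z::'a. complex_of_real (heat_kernel 1 z))"
    by (simp add: integrable_heat_kernel)
  \<comment> \<open>Substituting \<open>x = y + z / s\<close> moves the dependence on
    \<open>n\<close> from the kernel into the argument of \<open>p\<close>, so one fixed integrable
    kernel serves for all \<open>n\<close>.\<close>
  have I_eq: "?I n y = (LINT z|lborel. p (y + (1 / ?s n) *\<^sub>R z) * complex_of_real (heat_kernel 1 z))" for n y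
  proof -
    have "?I n y = \<bar>1 / ?s n\<bar> ^ DIM('a) *\<^sub>R
        (LINT z|lborel. p (y + (1 / ?s n) *\<^sub>R z) * complex_of_real (heat_kernel (?s n) (y - (y + (1 / ?s n) *\<^sub>R z))))"
      by (rule lborel_integral_affine) simp_all
    also have "(\<lambda>z. heat_kernel (?s n) (y - (y + (1 / ?s n) *\<^sub>R z))) = (\<lambda>z. ?s n ^ DIM('a) * heat_kernel 1 z)"
    proof
      fix z :: 'a
      have "y - (y + (1 / ?s n) *\<^sub>R z) = - ((1 / ?s n) *\<^sub>R z)" by simp
      then show "heat_kernel (?s n) (y - (y + (1 / ?s n) *\<^sub>R z)) = ?s n ^ DIM('a) * heat_kernel 1 z"
        by (simp only: heat_kernel_minus heat_kernel_rescale of_nat_0_less_iff zero_less_Suc)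
    qed
    then have "(LINT z|lborel. p (y + (1 / ?s n) *\<^sub>R z) * complex_of_real (heat_kernel (?s n) (y - (y + (1 / ?s n) *\<^sub>R z)))) =
        (LINT z|lborel. complex_of_real (?s n ^ DIM('a)) * (p (y + (1 / ?s n) *\<^sub>R z) * complex_of_real (heat_kernel 1 z)))"
      by (simp only: fun_eq_iff of_real_mult mult.left_commute)
    also have "\<dots> = complex_of_real (?s n ^ DIM('a)) * (LINT z|lborel. p (y + (1 / ?s n) *\<^sub>R z) * complex_of_real (heat_kernel 1 z))"
      by (rule integral_mult_right_zero)
    finally show ?thesis
      by (simp add: scaleR_conv_of_real power_divide del: of_nat_Suc)
  qed
  have I_bound: "cmod (?I n y) \<le> B * (2 * pi) ^ DIM('a)" for n y
  proof -
    have "cmod (?I n y) \<le> (LINT z|lborel. B * heat_kernel 1 (z::'a))"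
      unfolding I_eq
    proof (rule Bochner_Integration.integral_norm_bound_integral)
      show "integrable lborel (\<lambda>z::'a. B * heat_kernel 1 z)"
        by (simp add: integrable_heat_kernel)
      then show "integrable lborel (\<lambda>z. p (y + (1 / ?s n) *\<^sub>R z) * complex_of_real (heat_kernel 1 z))"
        by (rule Bochner_Integration.integrable_bound)
           (use bounded order_trans[OF norm_ge_zero bounded] in
             \<open>auto simp: norm_mult heat_kernel_pos less_imp_le intro!: mult_right_mono\<close>)
    qed (use bounded in \<open>auto simp: norm_mult heat_kernel_pos less_imp_le intro!: mult_right_mono\<close>)
    then show ?thesis
      by (simp add: integral_heat_kernel)
  qed
  \<comment> \<open>Approximation of the identity: for each fixed \<open>z\<close> the argument of
    \<open>p\<close> tends to \<open>y\<close>, so continuity at that single point suffices.\<close>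
  have I_lim: "(\<lambda>n. ?I n y) \<longlonglongrightarrow> p y * (2 * complex_of_real pi) ^ DIM('a)" if "isCont p y" for y
  proof -
    have "(\<lambda>n. ?I n y) \<longlonglongrightarrow> (LINT z|lborel. p y * complex_of_real (heat_kernel 1 (z::'a)))"
      unfolding I_eq
    proof (rule integral_dominated_convergence[where w = "\<lambda>z. B * heat_kernel 1 z"])
      show "integrable lborel (\<lambda>z::'a. B * heat_kernel 1 z)"
        by (simp add: integrable_heat_kernel)
      show "AE z in lborel. (\<lambda>n. p (y + (1 / ?s n) *\<^sub>R z) * complex_of_real (heat_kernel 1 z))
          \<longlonglongrightarrow> p y * complex_of_real (heat_kernel 1 z)"
      proof (rule AE_I2)
        fix z :: 'a
        have "(\<lambda>n. y + inverse (?s n) *\<^sub>R z) \<longlonglongrightarrow> y + 0 *\<^sub>R z"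
          by (intro tendsto_intros LIMSEQ_inverse_real_of_nat)
        then have "(\<lambda>n. y + (1 / ?s n) *\<^sub>R z) \<longlonglongrightarrow> y"
          by (simp add: inverse_eq_divide)
        with that have "(\<lambda>n. p (y + (1 / ?s n) *\<^sub>R z)) \<longlonglongrightarrow> p y"
          by (rule isCont_tendsto_compose)
        then show "(\<lambda>n. p (y + (1 / ?s n) *\<^sub>R z) * complex_of_real (heat_kernel 1 z))
          \<longlonglongrightarrow> p y * complex_of_real (heat_kernel 1 z)"
          by (rule tendsto_mult_right)
      qed
    qed (use bounded in \<open>auto simp: norm_mult heat_kernel_pos less_imp_le intro!: mult_right_mono\<close>)
    then show ?thesis
      by (simp add: integral_heat_kernel)
  qed
  have right: "(\<lambda>n. LINT y|lborel. F y * ?I n y) \<longlonglongrightarrow>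
      (LINT y|lborel. F y * (p y * (2 * complex_of_real pi) ^ DIM('a)))"
  proof (rule integral_dominated_convergence[where w = "\<lambda>y. cmod (F y) * (B * (2 * pi) ^ DIM('a))"])
    show "integrable lborel (\<lambda>y. cmod (F y) * (B * (2 * pi) ^ DIM('a)))"
      using F by (intro integrable_mult_left integrable_norm)
    show "AE y in lborel. (\<lambda>n. F y * ?I n y) \<longlonglongrightarrow> F y * (p y * (2 * complex_of_real pi) ^ DIM('a))"
      using cont by eventually_elim (rule tendsto_mult_left, rule I_lim)
    show "AE y in lborel. cmod (F y * ?I n y) \<le> cmod (F y) * (B * (2 * pi) ^ DIM('a))" for n
      using I_bound by (auto simp: norm_mult simp del: of_nat_Suc intro!: mult_left_mono)
  qed measurable
  have left: "(\<lambda>n. LINT w|lborel. fourier F w * fourier p (- w) * complex_of_real (gauss (?s n) w))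
      \<longlonglongrightarrow> (LINT w|lborel. fourier F w * fourier p (- w))"
  proof (rule integral_dominated_convergence[where w = "\<lambda>w. cmod (fourier F w) * (LINT x|lborel. cmod (p x))"])
    show "integrable lborel (\<lambda>w. cmod (fourier F w) * (LINT x|lborel. cmod (p x)))"
      using fF by (intro integrable_mult_left integrable_norm)
    have "(\<lambda>n. complex_of_real (gauss (?s n) w)) \<longlonglongrightarrow> complex_of_real 1" for w :: 'a
      by (rule tendsto_of_real[OF gauss_tendsto_1])
    from tendsto_mult_left[OF this]
    show "AE w in lborel. (\<lambda>n. fourier F w * fourier p (- w) * complex_of_real (gauss (?s n) w))
        \<longlonglongrightarrow> fourier F w * fourier p (- w)"
      by simp
    show "AE w in lborel. cmod (fourier F w * fourier p (- w) * complex_of_real (gauss (?s n) w))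
        \<le> cmod (fourier F w) * (LINT x|lborel. cmod (p x))" for n
    proof (rule AE_I2)
      fix w
      have "cmod (fourier F w) * (cmod (fourier p (- w)) * gauss (?s n) w)
          \<le> cmod (fourier F w) * ((LINT x|lborel. cmod (p x)) * 1)"
        by (intro mult_mono norm_fourier_le gauss_le_1) (auto simp: gauss_pos less_imp_le)
      then show "cmod (fourier F w * fourier p (- w) * complex_of_real (gauss (?s n) w))
        \<le> cmod (fourier F w) * (LINT x|lborel. cmod (p x))"
        by (simp add: norm_mult gauss_pos less_imp_le mult.assoc del: of_nat_Suc)
    qed
  qed measurable
  have "(LINT w|lborel. fourier F w * fourier p (- w) * complex_of_real (gauss (?s n) w)) =
      (LINT y|lborel. F y * ?I n y)" for n
    by (rule gauss_weighted_parseval[OF F p]) simp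
  with left right have "(LINT w|lborel. fourier F w * fourier p (- w)) =
      (LINT y|lborel. F y * (p y * (2 * complex_of_real pi) ^ DIM('a)))"
    by (auto intro: LIMSEQ_unique)
  then show ?thesis
    by (simp add: mult_ac flip: integral_mult_right_zero)
qed

text \<open>With \<open>H\<close> the conjugate of \<open>F\<close>, weighted Parseval turns the
  left side into a quadratic form whose kernel is the heat kernel.\<close>

lemma gauss_weighted_plancherel_le:
  fixes F :: "'a::euclidean_space \<Rightarrow> complex"
  assumes F: "integrable lborel F" and F2: "integrable lborel (\<lambda>x. (cmod (F x))\<^sup>2)" and s: "0 < s"
  shows "(LINT w|lborel. (cmod (fourier F w))\<^sup>2 * gauss s w) \<le> (2 * pi) ^ DIM('a) * (LINT x|lborel. (cmod (F x))\<^sup>2)"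
proof -
  have [measurable]: "F \<in> borel_measurable borel" "(\<lambda>x. cnj (F x)) \<in> borel_measurable borel"
    using borel_measurable_integrable[OF F] borel_measurable_integrable[OF integrable_cnj[OF F]] by simp_all
  let ?N = "LINT x|lborel. (cmod (F x))\<^sup>2"
  let ?h = "\<lambda>y x. heat_kernel s (y - x :: 'a)"
  have h_nonneg: "0 \<le> ?h y x" for y x
    using heat_kernel_pos[OF s] by (rule less_imp_le)
  have 1: "integrable (lborel \<Otimes>\<^sub>M lborel) (\<lambda>(y, x). (cmod (F y))\<^sup>2 * ?h y x)"
    by (rule lborel_pair.Fubini_integrable)
       (auto simp: h_nonneg abs_mult integral_heat_kernel_diff[OF s] integrable_heat_kernel_diff[OF s] F2)
  have 2: "integrable (lborel \<Otimes>\<^sub>M lborel) (\<lambda>(y, x). (cmod (F x))\<^sup>2 * ?h x y)"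
    using lborel_pair.integrable_product_swap[OF 1] by (simp add: case_prod_beta')
  have h_sym: "?h x y = ?h y x" for x y
    using heat_kernel_minus[of s "x - y"] by simp
  \<comment> \<open>A symmetrized majorant: it dominates the integrand of the quadratic form
    pointwise, and each half is integrated first over the variable that occurs only in the
    kernel.\<close>
  let ?S = "\<lambda>(y, x). ((cmod (F y))\<^sup>2 * ?h y x + (cmod (F x))\<^sup>2 * ?h x y) / 2"
  have S: "integrable (lborel \<Otimes>\<^sub>M lborel) ?S"
    using integrable_divide[OF Bochner_Integration.integrable_add[OF 1 2], of 2] by (simp add: case_prod_beta')
  have S_int: "integral\<^sup>L (lborel \<Otimes>\<^sub>M lborel) ?S = (2 * pi) ^ DIM('a) * ?N"
  proof -
    have "integral\<^sup>L (lborel \<Otimes>\<^sub>M lborel) (\<lambda>(y, x). (cmod (F y))\<^sup>2 * ?h y x) = (2 * pi) ^ DIM('a) * ?N"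
      by (subst lborel_pair.integral_fst[OF 1, symmetric]) (simp add: integral_heat_kernel_diff[OF s])
    moreover have "integral\<^sup>L (lborel \<Otimes>\<^sub>M lborel) (\<lambda>(y, x). (cmod (F x))\<^sup>2 * ?h x y) = (2 * pi) ^ DIM('a) * ?N"
      by (subst lborel_pair.integral_snd[OF 2, symmetric]) (simp add: integral_heat_kernel_diff[OF s])
    ultimately show ?thesis
      using 1 2 by (simp add: case_prod_beta')
  qed
  \<comment> \<open>Schur's test: \<open>2|F y||F x| \<le> |F y|\<^sup>2 + |F x|\<^sup>2\<close> under the kernel, which integrates to
    \<open>(2\<pi>)\<^sup>d\<close> in either variable.\<close>
  have inner: "AE y in lborel. cmod (F y * (LINT x|lborel. cnj (F x) * complex_of_real (?h y x))) \<le> (LINT x|lborel. ?S (y, x))"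
    using lborel_pair.AE_integrable_fst'[OF S]
  proof eventually_elim
    \<comment> \<open>Fubini gives integrable sections only for almost every \<open>y\<close>, which
      is why the estimate holds almost everywhere.\<close>
    fix y assume int: "integrable lborel (\<lambda>x. ?S (y, x))"
    have amgm: "cmod (F y * (cnj (F x) * complex_of_real (?h y x))) \<le> ?S (y, x)" for x
    proof -
      have "cmod (F y) * cmod (F x) \<le> ((cmod (F y))\<^sup>2 + (cmod (F x))\<^sup>2) / 2"
        using sum_squares_bound[of "cmod (F y)" "cmod (F x)"] by simp
      from mult_right_mono[OF this h_nonneg[of y x]] show ?thesis
        using h_nonneg by (simp add: norm_mult h_sym[of x y] field_simps)
    qed
    have "cmod (LINT x|lborel. F y * (cnj (F x) * complex_of_real (?h y x))) \<le> (LINT x|lborel. ?S (y, x))"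
    proof (rule Bochner_Integration.integral_norm_bound_integral[OF _ int amgm])
      show "integrable lborel (\<lambda>x. F y * (cnj (F x) * complex_of_real (?h y x)))"
      proof (rule Bochner_Integration.integrable_bound[OF int])
        show "(\<lambda>x. F y * (cnj (F x) * complex_of_real (?h y x))) \<in> borel_measurable lborel"
          by measurable
      qed (use order_trans[OF amgm abs_ge_self] in auto)
    qed
    then show "cmod (F y * (LINT x|lborel. cnj (F x) * complex_of_real (?h y x))) \<le> (LINT x|lborel. ?S (y, x))"
      by simp
  qed
  have S1: "integrable lborel (\<lambda>y. LINT x|lborel. ?S (y, x))"
    by (rule lborel_pair.integrable_fst'[OF S])
  \<comment> \<open>The integral is real; viewed as a complex number it fits the weighted identity,
    and it is then bounded by its modulus.\<close>
  have "complex_of_real (LINT w|lborel. (cmod (fourier F w))\<^sup>2 * gauss s w) =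
      (LINT w|lborel. fourier F w * fourier (\<lambda>x. cnj (F x)) (- w) * complex_of_real (gauss s w))"
    by (subst integral_complex_of_real[symmetric]) (simp only: cnj_fourier[symmetric] complex_norm_square of_real_mult)
  also have "\<dots> = (LINT y|lborel. F y * (LINT x|lborel. cnj (F x) * complex_of_real (?h y x)))"
    by (rule gauss_weighted_parseval[OF F _ s]) (simp add: F)
  finally have "(LINT w|lborel. (cmod (fourier F w))\<^sup>2 * gauss s w)
      \<le> cmod (LINT y|lborel. F y * (LINT x|lborel. cnj (F x) * complex_of_real (?h y x)))"
    by (metis abs_ge_self norm_of_real)
  also have "\<dots> \<le> (LINT y|lborel. cmod (F y * (LINT x|lborel. cnj (F x) * complex_of_real (?h y x))))"
    by (rule integral_norm_bound)
  also have "\<dots> \<le> (LINT y|lborel. LINT x|lborel. ?S (y, x))"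
    using inner
    by (intro integral_mono_AE[OF _ S1] Bochner_Integration.integrable_bound[OF S1] integrable_norm)
       (auto elim!: eventually_mono)
  also have "\<dots> = (2 * pi) ^ DIM('a) * ?N"
    unfolding S_int[symmetric] by (rule lborel_pair.integral_fst'[OF S])
  finally show ?thesis .
qed

text \<open>The weighted bound is uniform in the weight, so monotone convergence gives integrability
  and the inequality at once.\<close>

lemma
  fixes F :: "'a::euclidean_space \<Rightarrow> complex"
  assumes F: "integrable lborel F" and F2: "integrable lborel (\<lambda>x. (cmod (F x))\<^sup>2)"
  shows integrable_fourier_square: "integrable lborel (\<lambda>w. (cmod (fourier F w))\<^sup>2)"
    and plancherel_le:
      "(LINT w|lborel. (cmod (fourier F w))\<^sup>2) \<le> (2 * pi) ^ DIM('a) * (LINT x|lborel. (cmod (F x))\<^sup>2)"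
proof -
  have [measurable]: "F \<in> borel_measurable borel"
    using F by (simp add: borel_measurable_integrable)
  define G where "G n w = (cmod (fourier F w))\<^sup>2 * gauss (real (Suc n)) w" for n and w :: 'a
  have [measurable]: "G n \<in> borel_measurable borel" for n
    unfolding G_def[abs_def] by measurable
  have int: "integrable lborel (G n)" for n
  proof (rule Bochner_Integration.integrable_bound)
    show "integrable lborel (\<lambda>w::'a. (LINT x|lborel. cmod (F x))\<^sup>2 * gauss (real (Suc n)) w)"
      by (intro integrable_mult_right integrable_gauss) simp
  qed (auto simp: G_def abs_mult gauss_pos less_imp_le norm_fourier_le intro!: AE_I2 mult_right_mono power_mono)
  have mono: "mono (\<lambda>n. G n w)" for w
    by (auto simp: G_def mono_def intro!: mult_left_mono gauss_mono)
  have lim: "(\<lambda>n. G n w) \<longlonglongrightarrow> (cmod (fourier F w))\<^sup>2" for w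
    using tendsto_mult_left[OF gauss_tendsto_1, of "(cmod (fourier F w))\<^sup>2"] by (simp add: G_def)
  let ?R = "(2 * pi) ^ DIM('a) * (LINT x|lborel. (cmod (F x))\<^sup>2)"
  have bound: "integral\<^sup>L lborel (G n) \<le> ?R" for n
    unfolding G_def by (rule gauss_weighted_plancherel_le[OF F F2]) simp
  \<comment> \<open>Increasing and bounded by \<open>?R\<close>, the integrals converge to some
    \<open>L\<close>, which monotone convergence identifies as the integral of the limit.\<close>
  have "incseq (\<lambda>n. integral\<^sup>L lborel (G n))"
    unfolding incseq_def by (intro allI impI integral_mono int) (use mono in \<open>auto simp: mono_def\<close>)
  from incseq_convergent[OF this, of ?R] bound obtain L
    where L: "(\<lambda>n. integral\<^sup>L lborel (G n)) \<longlonglongrightarrow> L"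
    by blast
  have meas: "(\<lambda>w. (cmod (fourier F w))\<^sup>2) \<in> borel_measurable lborel" by measurable
  note mct = int AE_I2[OF mono] AE_I2[OF lim] L meas
  show "integrable lborel (\<lambda>w. (cmod (fourier F w))\<^sup>2)"
    by (rule integrable_monotone_convergence[OF mct])
  have "(LINT w|lborel. (cmod (fourier F w))\<^sup>2) = L"
    by (rule integral_monotone_convergence[OF mct])
  then show "(LINT w|lborel. (cmod (fourier F w))\<^sup>2) \<le> ?R"
    using LIMSEQ_le_const2[OF L] bound by auto
qed

section \<open>Bessel's inequality\<close>

text \<open>Domination by the sum of squares; it makes all inner products in Bessel's inequality
  genuine integrals.\<close>

lemma integrable_mult_of_square:
  fixes f g :: "'a \<Rightarrow> complex"
  assumes [measurable]: "f \<in> borel_measurable M" "g \<in> borel_measurable M"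
    and f: "integrable M (\<lambda>x. (cmod (f x))\<^sup>2)" and g: "integrable M (\<lambda>x. (cmod (g x))\<^sup>2)"
  shows "integrable M (\<lambda>x. f x * g x)"
proof (rule Bochner_Integration.integrable_bound)
  show "integrable M (\<lambda>x. (cmod (f x))\<^sup>2 + (cmod (g x))\<^sup>2)"
    using f g by simp
  have "cmod (f x * g x) \<le> (cmod (f x))\<^sup>2 + (cmod (g x))\<^sup>2" for x
  proof -
    have "2 * cmod (f x) * cmod (g x) \<le> (cmod (f x))\<^sup>2 + (cmod (g x))\<^sup>2"
      by (rule sum_squares_bound)
    moreover have "0 \<le> cmod (f x) * cmod (g x)"
      by simp
    ultimately show ?thesis
      unfolding norm_mult by linarith
  qed
  then show "AE x in M. cmod (f x * g x) \<le> norm ((cmod (f x))\<^sup>2 + (cmod (g x))\<^sup>2)"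
    by simp
qed measurable

lemma borel_measurable_cnj_comp:
  assumes "f \<in> borel_measurable M"
  shows "(\<lambda>x. cnj (f x)) \<in> borel_measurable M"
proof -
  have "cnj \<in> borel_measurable borel"
    by (intro borel_measurable_continuous_onI continuous_intros)
  from measurable_compose[OF assms this] show ?thesis .
qed

text \<open>The squared distance from \<open>g\<close> to its projection onto the span of the
  \<open>e k\<close> is nonnegative, and orthonormality evaluates it as the squared norm of
  \<open>g\<close> minus the sum.\<close>

lemma bessel_inequality:
  fixes e :: "'i \<Rightarrow> 'a \<Rightarrow> complex" and g :: "'a \<Rightarrow> complex"
  assumes I: "finite I"
    and e: "\<And>k. k \<in> I \<Longrightarrow> e k \<in> borel_measurable M" "\<And>k. k \<in> I \<Longrightarrow> integrable M (\<lambda>x. (cmod (e k x))\<^sup>2)"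
    and g: "g \<in> borel_measurable M" "integrable M (\<lambda>x. (cmod (g x))\<^sup>2)"
    and orthonormal: "\<And>j k. j \<in> I \<Longrightarrow> k \<in> I \<Longrightarrow> (LINT x|M. e j x * cnj (e k x)) = of_bool (j = k)"
  shows "(\<Sum>k\<in>I. (cmod (LINT x|M. g x * cnj (e k x)))\<^sup>2) \<le> (LINT x|M. (cmod (g x))\<^sup>2)"
proof -
  define c where "c k = (LINT x|M. g x * cnj (e k x))" for k
  let ?S = "\<Sum>k\<in>I. (cmod (c k))\<^sup>2"
  note cnj_meas = borel_measurable_cnj_comp
  have gg: "integrable M (\<lambda>x. g x * cnj (g x))"
    by (intro integrable_mult_of_square cnj_meas g) (simp add: g)
  have ge: "integrable M (\<lambda>x. g x * cnj (e k x))" if "k \<in> I" for k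
    by (intro integrable_mult_of_square cnj_meas g e that) (simp add: e that)
  have eg: "integrable M (\<lambda>x. e k x * cnj (g x))" if "k \<in> I" for k
    by (intro integrable_mult_of_square cnj_meas g e that) (simp add: g)
  have ee: "integrable M (\<lambda>x. e j x * cnj (e k x))" if "j \<in> I" "k \<in> I" for j k
    by (intro integrable_mult_of_square cnj_meas e that) (simp add: e that)
  have eg_int: "(LINT x|M. e k x * cnj (g x)) = cnj (c k)" for k
    unfolding c_def by (subst Bochner_Integration.integral_cnj[symmetric]) (simp add: mult.commute)
  have expand: "complex_of_real ((cmod (g x - (\<Sum>k\<in>I. c k * e k x)))\<^sup>2) =
      g x * cnj (g x) - (\<Sum>k\<in>I. cnj (c k) * (g x * cnj (e k x)))
        - (\<Sum>k\<in>I. c k * (e k x * cnj (g x)))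
        + (\<Sum>j\<in>I. \<Sum>k\<in>I. c j * cnj (c k) * (e j x * cnj (e k x)))" for x
  proof -
    let ?T = "\<Sum>k\<in>I. c k * e k x"
    have "complex_of_real ((cmod (g x - ?T))\<^sup>2) = (g x - ?T) * cnj (g x - ?T)"
      by (rule complex_norm_square)
    also have "\<dots> = g x * cnj (g x) - g x * cnj ?T - ?T * cnj (g x) + ?T * cnj ?T"
      by (simp only: complex_cnj_diff) (simp only: algebra_simps)
    also have "g x * cnj ?T = (\<Sum>k\<in>I. cnj (c k) * (g x * cnj (e k x)))"
      by (simp add: sum_distrib_left mult.left_commute)
    also have "?T * cnj (g x) = (\<Sum>k\<in>I. c k * (e k x * cnj (g x)))"
      by (simp add: sum_distrib_right mult.assoc)
    also have "?T * cnj ?T = (\<Sum>j\<in>I. \<Sum>k\<in>I. c j * cnj (c k) * (e j x * cnj (e k x)))"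
      by (simp add: sum_product mult_ac)
    finally show ?thesis .
  qed
  have "complex_of_real (LINT x|M. (cmod (g x - (\<Sum>k\<in>I. c k * e k x)))\<^sup>2) =
      (LINT x|M. g x * cnj (g x) - (\<Sum>k\<in>I. cnj (c k) * (g x * cnj (e k x)))
        - (\<Sum>k\<in>I. c k * (e k x * cnj (g x)))
        + (\<Sum>j\<in>I. \<Sum>k\<in>I. c j * cnj (c k) * (e j x * cnj (e k x))))"
    by (simp only: integral_complex_of_real[symmetric] expand)
  \<comment> \<open>Each cross sum subtracts \<open>?S\<close>, and the diagonal of the double sum
    adds it back once, so \<open>- ?S\<close> remains.\<close>
  also have "\<dots> = (LINT x|M. g x * cnj (g x)) - (\<Sum>k\<in>I. cnj (c k) * c k) - (\<Sum>k\<in>I. c k * cnj (c k))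
      + (\<Sum>j\<in>I. \<Sum>k\<in>I. c j * cnj (c k) * of_bool (j = k))"
    using gg ge eg ee
    by (simp add: Bochner_Integration.integral_sum orthonormal eg_int c_def[symmetric])
  also have "\<dots> = complex_of_real ((LINT x|M. (cmod (g x))\<^sup>2) - ?S)"
    using I by (simp add: complex_norm_square[symmetric] mult.commute[of "cnj _"] sum.delta' of_bool_def
        if_distrib cong: if_cong flip: of_real_power)
  finally have "(LINT x|M. (cmod (g x - (\<Sum>k\<in>I. c k * e k x)))\<^sup>2) = (LINT x|M. (cmod (g x))\<^sup>2) - ?S"
    by (simp only: of_real_eq_iff)
  moreover have "0 \<le> (LINT x|M. (cmod (g x - (\<Sum>k\<in>I. c k * e k x)))\<^sup>2)"
    by (intro integral_nonneg_AE AE_I2 zero_le_power2)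
  ultimately show ?thesis
    unfolding c_def by linarith
qed

section \<open>The cosine basis of a box\<close>

text \<open>The basis vectors of \<open>real ^ 'n\<close> are the axis vectors, so reindexing along
  \<open>axis_index\<close> turns products over \<open>Basis\<close> into products over
  coordinates.\<close>

lemma integral_lborel_prod_cart:
  fixes f :: "'n::finite \<Rightarrow> real \<Rightarrow> 'c::{real_normed_field,banach,second_countable_topology}"
  assumes f: "\<And>j. integrable lborel (f j)"
  shows "(LINT x|(lborel :: (real ^ 'n) measure). (\<Prod>j\<in>UNIV. f j (x $ j))) = (\<Prod>j\<in>UNIV. (LINT t|lborel. f j t))"
proof -
  have B: "(Basis :: (real ^ 'n) set) = range (\<lambda>j. axis j 1)"
    by (auto simp: Basis_vec_def)
  have inj: "inj (\<lambda>j::'n. axis j (1::real))"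
    by (auto simp: inj_def axis_eq_axis)
  have prod_Basis: "(\<Prod>b\<in>Basis. h b) = (\<Prod>j\<in>UNIV. h (axis j 1))" for h :: "real ^ 'n \<Rightarrow> 'c"
    unfolding B by (simp add: prod.reindex[OF inj])
  note f' = f[of "axis_index _"]
  show "(LINT x|(lborel :: (real ^ 'n) measure). (\<Prod>j\<in>UNIV. f j (x $ j))) = (\<Prod>j\<in>UNIV. (LINT t|lborel. f j t))"
    using integral_lborel_prod[of "\<lambda>b::real ^ 'n. f (axis_index b)", OF f']
    by (simp add: prod_Basis cart_eq_inner_axis)
qed

text \<open>The frequency index is an integer because it will be a difference of two indices. For
  \<open>n\<close> nonzero the antiderivative is a sine that vanishes at both ends.\<close>

lemma integral_cos_Icc:
  fixes n :: int
  assumes "a < b"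
  shows "(LINT x|lborel. indicator {a..b} x * cos (of_int n * pi / (b - a) * (x - a))) =
    (if n = 0 then b - a else 0)"
proof (cases "n = 0")
  case True
  then show ?thesis using assms by simp
next
  case False
  define w where "w = of_int n * pi / (b - a)"
  have w: "w \<noteq> 0" using False assms by (simp add: w_def)
  have "(LINT x|lborel. cos (w * (x - a)) * indicator {a..b} x) = sin (w * (b - a)) / w - sin (w * (a - a)) / w"
    by (rule integral_FTC_Icc_real) (use assms w in \<open>auto intro!: derivative_eq_intros\<close>)
  also have "w * (b - a) = of_int n * pi"
    using assms by (simp add: w_def)
  finally show ?thesis
    using False by (simp add: w_def mult.commute)
qed

lemma continuous_cosine_basis [continuous_intros]:
  fixes g :: "'a::t2_space \<Rightarrow> real"
  shows "continuous_on A g \<Longrightarrow> continuous_on A (\<lambda>x. cosine_basis a b k (g x))"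
  unfolding cosine_basis_def[abs_def]
  by (intro continuous_on_mult_left continuous_on_cos continuous_on_diff continuous_on_const)

text \<open>The product-to-sum formula reduces the inner product to single cosines with the
  difference and the sum of the two frequencies.\<close>

lemma cosine_basis_orthonormal:
  assumes ab: "a < b"
  shows "(LINT x|lborel. indicator {a..b} x * (cosine_basis a b j x * cosine_basis a b k x)) = of_bool (j = k)"
proof -
  let ?c = "\<lambda>n x. cos (real_of_int n * pi / (b - a) * (x - a))"
  let ?N = "cosine_norm_const a b j * cosine_norm_const a b k / 2"
  have int: "integrable lborel (\<lambda>x. indicator {a..b} x * ?c n x)" for n
  proof -
    have "continuous_on {a..b} (?c n)"
      by (intro continuous_on_cos continuous_on_mult_left continuous_on_diff continuous_on_const continuous_on_id)
    then show ?thesis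
      using borel_integrable_atLeastAtMost'[of a b "?c n"] by (simp add: set_integrable_def)
  qed
  have cc: "cos (real j * pi / (b - a) * (x - a)) * cos (real k * pi / (b - a) * (x - a)) =
      (?c (int j - int k) x + ?c (int j + int k) x) / 2" for x
    unfolding cos_times_cos by (simp add: algebra_simps diff_divide_distrib add_divide_distrib)
  have "(LINT x|lborel. indicator {a..b} x * (cosine_basis a b j x * cosine_basis a b k x)) =
      (LINT x|lborel. ?N * (indicator {a..b} x * ?c (int j - int k) x) + ?N * (indicator {a..b} x * ?c (int j + int k) x))"
  proof (rule Bochner_Integration.integral_cong[OF refl])
    fix x
    have "cosine_basis a b j x * cosine_basis a b k x = cosine_norm_const a b j * cosine_norm_const a b k *
        (cos (real j * pi / (b - a) * (x - a)) * cos (real k * pi / (b - a) * (x - a)))"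
      by (simp add: cosine_basis_def)
    then show "indicator {a..b} x * (cosine_basis a b j x * cosine_basis a b k x) =
        ?N * (indicator {a..b} x * ?c (int j - int k) x) + ?N * (indicator {a..b} x * ?c (int j + int k) x)"
      unfolding cc by (simp only:) (simp add: field_simps)
  qed
  also have "\<dots> = ?N * (if int j - int k = 0 then b - a else 0) + ?N * (if int j + int k = 0 then b - a else 0)"
    by (subst Bochner_Integration.integral_add)
       (simp_all only: integral_mult_right_zero integral_cos_Icc[OF ab] integrable_mult_right int)
  \<comment> \<open>For \<open>j = k = 0\<close> both terms contribute and \<open>?N\<close> is
    \<open>1 / (2 * (b - a))\<close>. For \<open>j = k > 0\<close> only the difference term survives
    and \<open>?N\<close> is \<open>1 / (b - a)\<close>. Otherwise both vanish.\<close>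
  also have "\<dots> = of_bool (j = k)"
    using ab by (auto simp: cosine_norm_const_def field_simps)
  finally show ?thesis .
qed

text \<open>Extension by zero turns integrals over the box into Fourier transforms and inner
  products over the whole space.\<close>

definition box_basis :: "real ^ 'n \<Rightarrow> real ^ 'n \<Rightarrow> ('n \<Rightarrow> nat) \<Rightarrow> real ^ 'n \<Rightarrow> complex" where
  "box_basis l u k x = complex_of_real (indicator (cbox l u) x * product_cosine_basis l u k x)"

lemma indicator_cbox_cart:
  "indicator (cbox l u) (x :: real ^ 'n) = (\<Prod>j\<in>UNIV. indicator {l $ j..u $ j} (x $ j) :: real)"
proof (cases "x \<in> cbox l u")
  case True
  then have "\<forall>j\<in>UNIV. indicator {l $ j..u $ j} (x $ j) = (1 :: real)"
    by (simp add: mem_box_cart indicator_eq_1_iff)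
  from prod.neutral[OF this] True show ?thesis by simp
next
  case False
  then obtain j where "indicator {l $ j..u $ j} (x $ j) = (0 :: real)"
    by (auto simp: mem_box_cart indicator_def)
  with False show ?thesis
    by (auto intro: prod_zero[symmetric])
qed

lemma continuous_product_cosine_basis: "continuous_on A (product_cosine_basis l u k)"
  unfolding product_cosine_basis_def[abs_def] by (intro continuous_intros)

lemma borel_measurable_box_basis [measurable]: "box_basis l u k \<in> borel_measurable borel"
proof -
  have [measurable]: "product_cosine_basis l u k \<in> borel_measurable borel"
    by (intro borel_measurable_continuous_onI continuous_product_cosine_basis)
  show ?thesis
    unfolding box_basis_def[abs_def] by measurable
qed

lemma box_basis_bounded: obtains B where "\<And>x. cmod (box_basis l u k x) \<le> B"
proof -
  have "compact (product_cosine_basis l u k ` cbox l u)"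
    by (intro compact_continuous_image continuous_product_cosine_basis compact_cbox)
  then have "\<exists>B>0. \<forall>y\<in>product_cosine_basis l u k ` cbox l u. norm y \<le> B"
    by (intro iffD1[OF bounded_pos] compact_imp_bounded)
  then obtain B where B: "\<And>x. x \<in> cbox l u \<Longrightarrow> \<bar>product_cosine_basis l u k x\<bar> \<le> B" "0 < B"
    by auto
  then have "cmod (box_basis l u k x) \<le> B" for x
    by (cases "x \<in> cbox l u") (auto simp: box_basis_def)
  with that show ?thesis .
qed

lemma integrable_box_basis: "integrable lborel (box_basis l u k)"
proof -
  have "integrable lborel (\<lambda>x. indicator (cbox l u) x *\<^sub>R product_cosine_basis l u k x)"
    by (intro borel_integrable_compact compact_cbox continuous_product_cosine_basis)
  then show ?thesis
    unfolding box_basis_def[abs_def] by (intro integrable_of_real) simp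
qed

text \<open>The boundary of the box is a null set; off it the function agrees locally with the
  continuous product or with zero.\<close>

lemma AE_isCont_box_basis: "AE x in lborel. isCont (box_basis l u k) x"
proof -
  have "cbox l u - box l u \<in> null_sets lborel"
    using negligible_frontier_interval[of l u]
    by (simp add: negligible_iff_null_sets null_sets_completion_iff)
  then have "AE x in lborel. x \<notin> cbox l u - box l u"
    by (rule AE_not_in)
  then show ?thesis
  proof eventually_elim
    fix x assume "x \<notin> cbox l u - box l u"
    then consider "x \<in> box l u" | "x \<in> - cbox l u" by blast
    then show "isCont (box_basis l u k) x"
    proof cases
      case 1
      have "continuous_on (box l u) (box_basis l u k) \<longleftrightarrow>
          continuous_on (box l u) (\<lambda>x. complex_of_real (product_cosine_basis l u k x))"
        using box_subset_cbox[of l u]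
        by (intro continuous_on_cong) (auto simp: box_basis_def indicator_def)
      moreover have "continuous_on (box l u) (\<lambda>x. complex_of_real (product_cosine_basis l u k x))"
        by (intro continuous_on_of_real continuous_product_cosine_basis)
      ultimately show ?thesis
        using 1 continuous_on_eq_continuous_at[OF open_box] by blast
    next
      case 2
      have "continuous_on (- cbox l u) (box_basis l u k) \<longleftrightarrow> continuous_on (- cbox l u) (\<lambda>x. 0 :: complex)"
        by (rule continuous_on_cong) (auto simp: box_basis_def)
      then have "continuous_on (- cbox l u) (box_basis l u k)"
        by simp
      from bspec[OF this[unfolded continuous_on_eq_continuous_at[OF open_Compl[OF closed_cbox]]] 2]
      show ?thesis .
    qed
  qed
qed

lemma integrable_box_basis_square: "integrable lborel (\<lambda>x. (cmod (box_basis l u k x))\<^sup>2)"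
proof -
  obtain B where B: "\<And>x. cmod (box_basis l u k x) \<le> B"
    using box_basis_bounded[of l u k] by blast
  show ?thesis
  proof (rule Bochner_Integration.integrable_bound)
    show "integrable lborel (\<lambda>x. B * cmod (box_basis l u k x))"
      by (intro integrable_mult_right integrable_norm integrable_box_basis)
    have "(cmod (box_basis l u k x))\<^sup>2 \<le> B * cmod (box_basis l u k x)" for x
      unfolding power2_eq_square by (intro mult_right_mono B norm_ge_zero)
    then show "AE x in lborel. norm ((cmod (box_basis l u k x))\<^sup>2) \<le> norm (B * cmod (box_basis l u k x))"
      using order_trans[OF _ abs_ge_self] by auto
  qed measurable
qed

text \<open>Fubini splits the inner product into one-dimensional ones, whose product is 1 exactly
  when the multi-indices agree in every coordinate.\<close>

lemma box_basis_orthonormal: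
  fixes l u :: "real ^ 'n"
  assumes box: "\<And>j. l $ j < u $ j"
  shows "(LINT x|lborel. box_basis l u i x * cnj (box_basis l u k x)) = of_bool (i = k)"
proof -
  let ?p = "\<lambda>j t. indicator {l $ j..u $ j} t * (cosine_basis (l $ j) (u $ j) (i j) t * cosine_basis (l $ j) (u $ j) (k j) t)"
  have int: "integrable lborel (?p j)" for j
    using borel_integrable_atLeastAtMost'[of "l $ j" "u $ j"
        "\<lambda>t. cosine_basis (l $ j) (u $ j) (i j) t * cosine_basis (l $ j) (u $ j) (k j) t"]
    by (simp add: set_integrable_def continuous_intros)
  have "box_basis l u i x * cnj (box_basis l u k x) = complex_of_real (\<Prod>j\<in>UNIV. ?p j (x $ j))" for x
  proof -
    have "(\<Prod>j\<in>UNIV. ?p j (x $ j)) = indicator (cbox l u) x * (product_cosine_basis l u i x * product_cosine_basis l u k x)"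
      by (simp add: prod.distrib indicator_cbox_cart product_cosine_basis_def)
    then show ?thesis
      by (simp add: box_basis_def indicator_def)
  qed
  then have "(LINT x|lborel. box_basis l u i x * cnj (box_basis l u k x)) =
      complex_of_real (LINT x|lborel. (\<Prod>j\<in>UNIV. ?p j (x $ j)))"
    by (simp only: integral_complex_of_real)
  also have "\<dots> = complex_of_real (\<Prod>j\<in>UNIV. of_bool (i j = k j))"
    by (simp only: integral_lborel_prod_cart[OF int] cosine_basis_orthonormal[OF box])
  also have "\<dots> = of_bool (i = k)"
    by (auto simp: fun_eq_iff of_bool_def)
  finally show ?thesis .
qed

section \<open>The truncation error\<close>

lemma finite_retained_indices: "finite (retained_indices (K :: 'n::finite \<Rightarrow> nat))"
proof -
  have "retained_indices K = PiE UNIV (\<lambda>j. {..<K j})"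
    by (auto simp: retained_indices_def)
  then show ?thesis
    by (simp add: finite_PiE)
qed

lemma joint_char_fun_eq_fourier: "joint_char_fun f = fourier (\<lambda>x. complex_of_real (f x))"
  by (simp add: fun_eq_iff joint_char_fun_def fourier_def)

text \<open>A characteristic function is bounded by the L1 norm of \<open>f\<close>, so its square
  is dominated by a multiple of its modulus. Hence the tail integrals are genuine values, not the
  default 0 of a divergent integral.\<close>

lemma integrable_joint_char_fun_square:
  assumes char: "integrable lborel (joint_char_fun f)"
  shows "integrable lborel (\<lambda>w. (cmod (joint_char_fun f w))\<^sup>2)"
proof (rule Bochner_Integration.integrable_bound)
  let ?B = "LINT x|lborel. \<bar>f x\<bar>"
  show "integrable lborel (\<lambda>w. ?B * cmod (joint_char_fun f w))"
    using char by simp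
  have [measurable]: "joint_char_fun f \<in> borel_measurable borel"
    using borel_measurable_integrable[OF char] by simp
  show "(\<lambda>w. (cmod (joint_char_fun f w))\<^sup>2) \<in> borel_measurable lborel"
    by measurable
  have "cmod (joint_char_fun f w) \<le> ?B" for w
    using norm_fourier_le[of "\<lambda>x. complex_of_real (f x)" w] by (simp add: joint_char_fun_eq_fourier)
  then have "cmod (joint_char_fun f w) * cmod (joint_char_fun f w) \<le> ?B * cmod (joint_char_fun f w)" for w
    by (rule mult_right_mono) simp
  then show "AE w in lborel. norm ((cmod (joint_char_fun f w))\<^sup>2) \<le> norm (?B * cmod (joint_char_fun f w))"
    by (auto simp: power2_eq_square abs_mult intro: order_trans)
qed

lemma basis_transform_eq_fourier: "basis_transform l u k w = fourier (box_basis l u k) (- w)"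
  unfolding basis_transform_def fourier_def set_lebesgue_integral_def
  by (rule Bochner_Integration.integral_cong[OF refl])
     (simp add: box_basis_def scaleR_conv_of_real mult_ac)

text \<open>Parseval with the density as the factor whose transform is integrable and the basis
  function as the bounded, almost everywhere continuous one.\<close>

lemma cosine_coeff_eq_parseval:
  fixes f :: "real ^ 'n \<Rightarrow> real"
  assumes f: "integrable lborel f" and char: "integrable lborel (joint_char_fun f)"
  shows "(2 * complex_of_real pi) ^ CARD('n) * complex_of_real (cosine_coeff f l u k) =
    (LINT w|lborel. joint_char_fun f w * basis_transform l u k w)"
proof -
  obtain B where B: "\<And>x. cmod (box_basis l u k x) \<le> B"
    using box_basis_bounded[of l u k] by blast
  have "(LINT w|lborel. joint_char_fun f w * basis_transform l u k w) =
      (2 * complex_of_real pi) ^ DIM(real ^ 'n) * (LINT y|lborel. complex_of_real (f y) * box_basis l u k y)"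
    unfolding joint_char_fun_eq_fourier basis_transform_eq_fourier
    by (rule parseval_fourier[OF _ integrable_box_basis B AE_isCont_box_basis])
       (use f char in \<open>simp_all add: joint_char_fun_eq_fourier\<close>)
  also have "(LINT y|lborel. complex_of_real (f y) * box_basis l u k y) = complex_of_real (cosine_coeff f l u k)"
    unfolding cosine_coeff_def set_lebesgue_integral_def
    by (subst integral_complex_of_real[symmetric]) (simp add: box_basis_def mult_ac)
  finally show ?thesis
    by simp
qed

text \<open>All error entries are, up to one constant, coefficients of the same function
  \<open>g\<close> in an orthonormal system. Bessel therefore bounds them jointly, with no factor
  counting the retained indices.\<close>

lemma truncation_error_le:
  fixes f :: "real ^ 'n \<Rightarrow> real" and l u \<Omega> :: "real ^ 'n"
  assumes box: "\<And>j. l $ j < u $ j"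
    and f: "integrable lborel f" and char: "integrable lborel (joint_char_fun f)"
  shows "(\<Sum>k\<in>retained_indices K.
      (cmod (complex_of_real (cosine_coeff f l u k) - truncated_cosine_coeff f l u \<Omega> k))\<^sup>2)
    \<le> (LINT w:- cbox (- \<Omega>) \<Omega>|lborel. (cmod (joint_char_fun f w))\<^sup>2) / (2 * pi) ^ CARD('n)"
proof -
  let ?\<phi> = "joint_char_fun f" and ?D = "(2 * complex_of_real pi) ^ CARD('n)"
  define h where "h w = indicator (- cbox (- \<Omega>) \<Omega>) w *\<^sub>R ?\<phi> w" for w
  \<comment> \<open>The unnormalized inverse transform of the discarded frequencies.\<close>
  define g where "g x = fourier h (- x)" for x
  have [measurable]: "?\<phi> \<in> borel_measurable borel"
    using char by (simp add: borel_measurable_integrable)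
  have h: "integrable lborel h"
    unfolding h_def by (rule integrable_mult_indicator) (auto simp: char)
  have [measurable]: "h \<in> borel_measurable borel"
    using h by (simp add: borel_measurable_integrable)
  have "integrable lborel (\<lambda>w. indicator (- cbox (- \<Omega>) \<Omega>) w *\<^sub>R (cmod (?\<phi> w))\<^sup>2)"
    by (rule integrable_mult_indicator[OF _ integrable_joint_char_fun_square[OF char]]) simp
  moreover have h_square: "(cmod (h w))\<^sup>2 = indicator (- cbox (- \<Omega>) \<Omega>) w *\<^sub>R (cmod (?\<phi> w))\<^sup>2" for w
    by (simp add: h_def indicator_def)
  ultimately have h2: "integrable lborel (\<lambda>w. (cmod (h w))\<^sup>2)"
    by simp
  \<comment> \<open>The Plancherel bound concerns \<open>fourier\<close> at \<open>x\<close>;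
    conjugating \<open>h\<close> removes the reflection in \<open>g\<close> without changing the
    modulus.\<close>
  have g_norm: "cmod (g x) = cmod (fourier (\<lambda>w. cnj (h w)) x)" for x
    using cnj_fourier[of h "- x"] complex_mod_cnj[of "fourier h (- x)"] by (simp add: g_def)
  have cnj_h: "integrable lborel (\<lambda>w. cnj (h w))" "integrable lborel (\<lambda>w. (cmod (cnj (h w)))\<^sup>2)"
    using h h2 by simp_all
  have g2: "integrable lborel (\<lambda>x. (cmod (g x))\<^sup>2)"
    and g2_le: "(LINT x|lborel. (cmod (g x))\<^sup>2) \<le> (2 * pi) ^ CARD('n) * (LINT w|lborel. (cmod (h w))\<^sup>2)"
    using integrable_fourier_square[OF cnj_h] plancherel_le[OF cnj_h] by (simp_all add: g_norm)
  \<comment> \<open>Subtracting the integral over the box leaves \<open>h\<close> paired with the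
    transformed basis function; the multiplication formula with \<open>c = -1\<close> moves the
    transform onto \<open>h\<close>. The conjugate is harmless because the basis is
    real-valued.\<close>
  have err: "complex_of_real (cosine_coeff f l u k) - truncated_cosine_coeff f l u \<Omega> k =
      (LINT x|lborel. g x * cnj (box_basis l u k x)) / ?D" for k
  proof -
    let ?F = "fourier (box_basis l u k)"
    have int: "integrable lborel (\<lambda>w. ?\<phi> w * ?F (- w))"
      using integrable_mult_fourier[OF integrable_box_basis[of l u k] char, of "-1"] by simp
    have "integrable lborel (\<lambda>w. indicator (cbox (- \<Omega>) \<Omega>) w *\<^sub>R (?\<phi> w * ?F (- w)))"
      by (rule integrable_mult_indicator[OF _ int]) simp
    then have "(LINT w|lborel. ?\<phi> w * ?F (- w)) - (LINT w:cbox (- \<Omega>) \<Omega>|lborel. ?\<phi> w * ?F (- w)) =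
        (LINT w|lborel. ?\<phi> w * ?F (- w) - indicator (cbox (- \<Omega>) \<Omega>) w *\<^sub>R (?\<phi> w * ?F (- w)))"
      unfolding set_lebesgue_integral_def by (rule Bochner_Integration.integral_diff[OF int, symmetric])
    also have "\<dots> = (LINT w|lborel. h w * ?F (- w))"
      by (rule Bochner_Integration.integral_cong[OF refl]) (auto simp: h_def indicator_def)
    also have "\<dots> = (LINT x|lborel. g x * cnj (box_basis l u k x))"
      using fourier_multiplication_formula[OF integrable_box_basis h, of l u k "-1"]
      by (simp add: g_def box_basis_def mult.commute)
    finally show ?thesis
      using cosine_coeff_eq_parseval[OF f char, of l u k]
      by (simp add: truncated_cosine_coeff_def basis_transform_eq_fourier field_simps)
  qed
  have "(\<Sum>k\<in>retained_indices K. (cmod (LINT x|lborel. g x * cnj (box_basis l u k x)))\<^sup>2) \<le> (LINT x|lborel. (cmod (g x))\<^sup>2)"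
    by (rule bessel_inequality)
       (simp_all add: finite_retained_indices integrable_box_basis_square box_basis_orthonormal[OF box] g2,
        simp add: g_def[abs_def])
  with g2_le have bound: "(\<Sum>k\<in>retained_indices K. (cmod (LINT x|lborel. g x * cnj (box_basis l u k x)))\<^sup>2)
      \<le> (2 * pi) ^ CARD('n) * (LINT w|lborel. (cmod (h w))\<^sup>2)"
    by linarith
  have "(\<Sum>k\<in>retained_indices K.
      (cmod (complex_of_real (cosine_coeff f l u k) - truncated_cosine_coeff f l u \<Omega> k))\<^sup>2) =
      (\<Sum>k\<in>retained_indices K. (cmod (LINT x|lborel. g x * cnj (box_basis l u k x)))\<^sup>2) / ((2 * pi) ^ CARD('n))\<^sup>2"
    by (simp add: err norm_divide norm_power norm_mult power_divide sum_divide_distrib)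
  also have "\<dots> \<le> (2 * pi) ^ CARD('n) * (LINT w|lborel. (cmod (h w))\<^sup>2) / ((2 * pi) ^ CARD('n))\<^sup>2"
    by (intro divide_right_mono bound) simp
  \<comment> \<open>One factor \<open>(2 * pi) ^ CARD('n)\<close> from Plancherel against two from
    the squared normalization.\<close>
  also have "\<dots> = (LINT w|lborel. (cmod (h w))\<^sup>2) / (2 * pi) ^ CARD('n)"
    by (simp add: power2_eq_square)
  also have "(LINT w|lborel. (cmod (h w))\<^sup>2) = (LINT w:- cbox (- \<Omega>) \<Omega>|lborel. (cmod (?\<phi> w))\<^sup>2)"
    by (simp add: set_lebesgue_integral_def h_square)
  finally show ?thesis .
qed

text \<open>A union bound: a point outside the box has some coordinate beyond its half-width, so one
  of the nonnegative summands already equals the integrand.\<close>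

lemma set_integral_Compl_cbox_le:
  fixes \<Omega> :: "real ^ 'n" and F :: "real ^ 'n \<Rightarrow> real"
  assumes F: "integrable lborel F" and nonneg: "\<And>w. 0 \<le> F w"
  shows "(LINT w:- cbox (- \<Omega>) \<Omega>|lborel. F w) \<le> (\<Sum>j\<in>UNIV. (LINT w:{w. \<Omega> $ j < \<bar>w $ j\<bar>}|lborel. F w))"
proof -
  have [measurable]: "{w :: real ^ 'n. \<Omega> $ j < \<bar>w $ j\<bar>} \<in> sets borel" for j
    by measurable
  have int: "integrable lborel (\<lambda>w. indicator A w *\<^sub>R F w)" if "A \<in> sets borel" for A
    by (rule integrable_mult_indicator) (use that F in auto)
  have "(LINT w:- cbox (- \<Omega>) \<Omega>|lborel. F w) \<le> (LINT w|lborel. (\<Sum>j\<in>UNIV. indicator {w. \<Omega> $ j < \<bar>w $ j\<bar>} w *\<^sub>R F w))"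
    unfolding set_lebesgue_integral_def
  proof (rule integral_mono)
    fix w
    show "indicator (- cbox (- \<Omega>) \<Omega>) w *\<^sub>R F w \<le> (\<Sum>j\<in>UNIV. indicator {w. \<Omega> $ j < \<bar>w $ j\<bar>} w *\<^sub>R F w)"
    proof (cases "w \<in> cbox (- \<Omega>) \<Omega>")
      case True
      then show ?thesis by (simp add: sum_nonneg nonneg)
    next
      case False
      then obtain j where "\<not> ((- \<Omega>) $ j \<le> w $ j \<and> w $ j \<le> \<Omega> $ j)"
        unfolding mem_box_cart by blast
      then have "\<Omega> $ j < \<bar>w $ j\<bar>"
        unfolding vector_uminus_component by linarith
      then have "F w = indicator {w. \<Omega> $ j < \<bar>w $ j\<bar>} w *\<^sub>R F w"
        by simp
      also have "\<dots> \<le> (\<Sum>j\<in>UNIV. indicator {w. \<Omega> $ j < \<bar>w $ j\<bar>} w *\<^sub>R F w)"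
        by (rule member_le_sum) (auto simp: nonneg)
      finally show ?thesis using False by simp
    qed
  qed (intro int Bochner_Integration.integrable_sum; measurable)+
  also have "\<dots> = (\<Sum>j\<in>UNIV. (LINT w:{w. \<Omega> $ j < \<bar>w $ j\<bar>}|lborel. F w))"
    unfolding set_lebesgue_integral_def by (intro Bochner_Integration.integral_sum int) measurable
  finally show ?thesis .
qed

text \<open>Solves the tail bound for the cutoff: raising the threshold to the power
  \<open>q\<close> gives \<open>C / a \<le> s powr q\<close>.\<close>

lemma powr_tail_le:
  fixes C q s a :: real
  assumes "0 \<le> C" "0 < q" "0 < s" "0 < a" and s: "(C / a) powr (1 / q) \<le> s"
  shows "C * s powr (- q) \<le> a"
proof (cases "C = 0")
  case True
  then show ?thesis using assms by simp
next
  case False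
  have "C / a = ((C / a) powr (1 / q)) powr q"
    using assms False by (simp add: powr_powr)
  also have "\<dots> \<le> s powr q"
    using assms by (intro powr_mono2) auto
  finally show ?thesis
    using assms by (simp add: powr_minus field_simps)
qed

theorem proposition5p1:
  fixes f :: "real ^ 'n \<Rightarrow> real"
    and l u \<Omega> :: "real ^ 'n"
    and K :: "'n \<Rightarrow> nat"
    and C q \<kappa> :: "'n \<Rightarrow> real"
    and \<tau> :: real
  assumes box: "\<And>j. l $ j < u $ j"
    and f_cont: "continuous_on UNIV f"
    and f_nonneg: "\<And>x. 0 \<le> f x"
    and f_L1: "integrable lborel f"
    and f_prob: "(LINT x|lborel. f x) = 1"
    and f_L2: "set_integrable lborel (cbox l u) (\<lambda>x. (f x)\<^sup>2)"
    and char_L1: "integrable lborel (joint_char_fun f)"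
    and K_pos: "\<And>j. 1 \<le> K j"
    and \<Omega>_pos: "\<And>j. 0 < \<Omega> $ j"
    and \<tau>_pos: "0 < \<tau>"
    and q_pos: "\<And>j. 0 < q j"
    and tail: "\<And>j s. 0 < s \<Longrightarrow>
      sqrt (LINT \<omega>:{\<omega>. s < \<bar>\<omega> $ j\<bar>}|lborel. (cmod (joint_char_fun f \<omega>))\<^sup>2)
        \<le> C j * s powr (- q j)"
    and \<kappa>_eq: "\<And>j. \<kappa> j = (real (K j) - 1) * pi / (u $ j - l $ j)"
    and \<Omega>_ge: "\<And>j. \<Omega> $ j \<ge>
      max (\<kappa> j)
        ((sqrt (real CARD('n)) * C j / ((2 * pi) powr (real CARD('n) / 2) * \<tau>)) powr (1 / q j))"
  shows "(\<forall>j. \<forall>k < K j.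
             real k * pi / (u $ j - l $ j) \<in> {- (\<Omega> $ j) .. \<Omega> $ j} \<and>
             - (real k * pi / (u $ j - l $ j)) \<in> {- (\<Omega> $ j) .. \<Omega> $ j})
         \<and> frobenius_norm K
             (\<lambda>k. complex_of_real (cosine_coeff f l u k) - truncated_cosine_coeff f l u \<Omega> k) \<le> \<tau>"
proof (intro conjI allI impI)
  fix j k assume "k < K j"
  \<comment> \<open>The strict inequality of naturals gains the 1 that appears in the numerator of
    \<open>\<kappa> j\<close>.\<close>
  then have "real k \<le> real (K j) - 1"
    by linarith
  then have "real k * pi / (u $ j - l $ j) \<le> \<kappa> j"
    unfolding \<kappa>_eq using box[of j] by (intro divide_right_mono mult_right_mono) auto
  then have le: "real k * pi / (u $ j - l $ j) \<le> \<Omega> $ j"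
    using \<Omega>_ge[of j] by simp
  have ge: "0 \<le> real k * pi / (u $ j - l $ j)"
    using box[of j] by simp
  show "real k * pi / (u $ j - l $ j) \<in> {- (\<Omega> $ j) .. \<Omega> $ j}"
    and "- (real k * pi / (u $ j - l $ j)) \<in> {- (\<Omega> $ j) .. \<Omega> $ j}"
    using le ge \<Omega>_pos[of j] by auto
next
  let ?\<phi> = "joint_char_fun f" and ?d = "real CARD('n)"
  \<comment> \<open>The tail allowed to each coordinate: the lower bound on
    \<open>\<Omega> $ j\<close> is \<open>(C j / ?a) powr (1 / q j)\<close>, and
    \<open>CARD('n)\<close> copies of \<open>?a\<^sup>2\<close> add up to
    \<open>(2 * pi) ^ CARD('n) * \<tau>\<^sup>2\<close>.\<close>
  let ?a = "(2 * pi) powr (?d / 2) * \<tau> / sqrt ?d"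
  have a_pos: "0 < ?a"
    using \<tau>_pos by simp
  have a_square: "?a\<^sup>2 = (2 * pi) ^ CARD('n) * \<tau>\<^sup>2 / ?d"
    by (simp add: power_divide power_mult_distrib powr_half_sqrt_powr powr_realpow)
  \<comment> \<open>The tail bound at \<open>s = 1\<close>, where the power equals 1, puts a square
    root below \<open>C j\<close>.\<close>
  have C_nonneg: "0 \<le> C j" for j
  proof -
    have "0 \<le> sqrt (LINT \<omega>:{\<omega>. 1 < \<bar>\<omega> $ j\<bar>}|lborel. (cmod (?\<phi> \<omega>))\<^sup>2)"
      unfolding set_lebesgue_integral_def by (intro real_sqrt_ge_zero integral_nonneg_AE AE_I2) simp
    also have "\<dots> \<le> C j"
      using tail[of 1 j] by simp
    finally show ?thesis .
  qed
  have tail_square: "(LINT \<omega>:{\<omega>. \<Omega> $ j < \<bar>\<omega> $ j\<bar>}|lborel. (cmod (?\<phi> \<omega>))\<^sup>2) \<le> ?a\<^sup>2" for j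
  proof -
    have "(C j / ?a) powr (1 / q j) \<le> \<Omega> $ j"
      using \<Omega>_ge[of j] by (simp add: mult.commute)
    then have "C j * (\<Omega> $ j) powr (- q j) \<le> ?a"
      by (rule powr_tail_le[OF C_nonneg q_pos \<Omega>_pos a_pos])
    with tail[OF \<Omega>_pos, of j] have "sqrt (LINT \<omega>:{\<omega>. \<Omega> $ j < \<bar>\<omega> $ j\<bar>}|lborel. (cmod (?\<phi> \<omega>))\<^sup>2) \<le> ?a"
      by (rule order_trans)
    then show ?thesis
      by (rule sqrt_le_D)
  qed
  have "(LINT w:- cbox (- \<Omega>) \<Omega>|lborel. (cmod (?\<phi> w))\<^sup>2)
      \<le> (\<Sum>j\<in>UNIV. (LINT w:{w. \<Omega> $ j < \<bar>w $ j\<bar>}|lborel. (cmod (?\<phi> w))\<^sup>2))"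
    by (rule set_integral_Compl_cbox_le[OF integrable_joint_char_fun_square[OF char_L1]]) simp
  also have "\<dots> \<le> (\<Sum>j\<in>(UNIV :: 'n set). ?a\<^sup>2)"
    by (intro sum_mono tail_square)
  also have "\<dots> = (2 * pi) ^ CARD('n) * \<tau>\<^sup>2"
    unfolding a_square by simp
  finally have "(\<Sum>k\<in>retained_indices K.
      (cmod (complex_of_real (cosine_coeff f l u k) - truncated_cosine_coeff f l u \<Omega> k))\<^sup>2)
      \<le> (2 * pi) ^ CARD('n) * \<tau>\<^sup>2 / (2 * pi) ^ CARD('n)"
    by (intro order_trans[OF truncation_error_le[OF box f_L1 char_L1]] divide_right_mono) auto
  then show "frobenius_norm K
      (\<lambda>k. complex_of_real (cosine_coeff f l u k) - truncated_cosine_coeff f l u \<Omega> k) \<le> \<tau>"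
    unfolding frobenius_norm_def using \<tau>_pos by (simp add: real_le_lsqrt sqrt_le_D)
qed

end
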